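(* Let $G=(V,E)$ be the graph with vertex set $V=\{a,b,c,d,e\}$ and edge set $E=\{\{a,b\},\{b,c\},\{c,d\},\{d,e\},\{e,a\},\{b,d\}\}$. Then every minimum planar arrangement $\pi$ of $G$ has cost $\sum_{\{u,v\}\in E}|\pi(u)-\pi(v)|$ strictly larger than $9$.
   Context: For a graph $G=(V,E)$ with $n=|V|$ vertices, a linear arrangement of $G$ is a bijection $\pi: V\to\{1,\dots,n\}$, and its cost is $\sum_{\{u,v\}\in E}|\pi(u)-\pi(v)|$. Two distinct edges $\{u,v\},\{x,y\}\in E$ cross in $\pi$ if, for some labeling of their endpoints, $\pi(u)<\pi(x)<\pi(v)<\pi(y)$. Following the paper's terminology, a "minimum planar arrangement" of $G$ is any linear arrangement $\pi$ of $G$ in which no two edges of $G$ cross (no minimality of cost is part of this definition). *)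

theory Defs
  imports Main
begin

text \<open>A finite simple graph is given by its vertex set \<open>V\<close> and its set \<open>E\<close> of edges, each edge
  being a two-element subset of \<open>V\<close>.\<close>

definition linear_arrangement :: "'v set \<Rightarrow> ('v \<Rightarrow> nat) \<Rightarrow> bool" where
  "linear_arrangement V \<pi> \<longleftrightarrow> bij_betw \<pi> V {1..card V}"

definition edge_length :: "('v \<Rightarrow> nat) \<Rightarrow> 'v set \<Rightarrow> int" where
  "edge_length \<pi> e = (THE l. \<exists>u v. e = {u, v} \<and> l = \<bar>int (\<pi> u) - int (\<pi> v)\<bar>)"

lemma edge_length_doubleton: "edge_length \<pi> {u, v} = \<bar>int (\<pi> u) - int (\<pi> v)\<bar>"
  unfolding edge_length_def by (rule the_equality) (auto simp: doubleton_eq_iff)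

definition arrangement_cost :: "'v set set \<Rightarrow> ('v \<Rightarrow> nat) \<Rightarrow> int" where
  "arrangement_cost E \<pi> = (\<Sum>e\<in>E. edge_length \<pi> e)"

text \<open>The equation between sets of edges lets either edge play the role of \<open>{u, v}\<close>, so that
  crossing is symmetric.\<close>

definition edges_cross :: "('v \<Rightarrow> nat) \<Rightarrow> 'v set \<Rightarrow> 'v set \<Rightarrow> bool" where
  "edges_cross \<pi> e f \<longleftrightarrow> e \<noteq> f \<and>
     (\<exists>u v x y. {e, f} = {{u, v}, {x, y}} \<and> \<pi> u < \<pi> x \<and> \<pi> x < \<pi> v \<and> \<pi> v < \<pi> y)"

text \<open>Despite the name, minimality of the cost is not required.\<close>

definition minimum_planar_arrangement :: "'v set \<Rightarrow> 'v set set \<Rightarrow> ('v \<Rightarrow> nat) \<Rightarrow> bool" where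
  "minimum_planar_arrangement V E \<pi> \<longleftrightarrow>
     linear_arrangement V \<pi> \<and> (\<forall>e\<in>E. \<forall>f\<in>E. \<not> edges_cross \<pi> e f)"

end

theory Submission
  imports Defs
begin

text \<open>The 5-cycle through \<open>a, b, c, d, e\<close> covers each of the 4 gaps between
  consecutive positions a positive even number of times, so it costs 8 or at least 10. In the latter
  case the chord \<open>{b, d}\<close> adds at least 1. If it costs 8, it consists of two monotone
  paths between positions 1 and 5, and planarity forces one of them to be a single edge; hence
  neighbouring positions are neighbours on the cycle. As \<open>b\<close> and \<open>d\<close> are
  not, the chord has length at least 2. The formal proof replaces this argument by a finite check,
  \<open>noncrossing_positions_cost\<close>, on positions alone;
  \<open>edges_cross_if_intervals_cross\<close> transfers planarity to them.\<close>

text \<open>Taking \<open>min\<close> and \<open>max\<close> makes the order of endpoints irrelevant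
  and leaves pure arithmetic without existential labels. Unlike \<open>edges_cross\<close>, the
  relation is not symmetric: \<open>I\<close> starts first.\<close>

definition intervals_cross :: "nat \<times> nat \<Rightarrow> nat \<times> nat \<Rightarrow> bool" where
  "intervals_cross I J \<longleftrightarrow> min (fst I) (snd I) < min (fst J) (snd J)
     \<and> min (fst J) (snd J) < max (fst I) (snd I) \<and> max (fst I) (snd I) < max (fst J) (snd J)"

lemma edges_cross_if_intervals_cross:
  assumes "intervals_cross (\<pi> u, \<pi> v) (\<pi> x, \<pi> y)"
  shows "edges_cross \<pi> {u, v} {x, y}"
proof -
  obtain u' v' where 1: "{u, v} = {u', v'}" "\<pi> u' = min (\<pi> u) (\<pi> v)" "\<pi> v' = max (\<pi> u) (\<pi> v)"
    by (metis insert_commute max_def min_def)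
  obtain x' y' where 2: "{x, y} = {x', y'}" "\<pi> x' = min (\<pi> x) (\<pi> y)" "\<pi> y' = max (\<pi> x) (\<pi> y)"
    by (metis insert_commute max_def min_def)
  have lt: "\<pi> u' < \<pi> x'" "\<pi> x' < \<pi> v'" "\<pi> v' < \<pi> y'"
    using assms 1 2 by (auto simp: intervals_cross_def)
  then have "{u', v'} \<noteq> {x', y'}"
    by (auto simp: doubleton_eq_iff)
  with lt show ?thesis
    unfolding edges_cross_def 1(1) 2(1) by blast
qed

lemma noncrossing_positions_cost:
  fixes p q r s t :: nat
  assumes dist: "distinct [p, q, r, s, t]" and ran: "set [p, q, r, s, t] \<subseteq> {1, 2, 3, 4, 5}"
    and nc: "\<And>I J. I \<in> {(p, q), (q, r), (r, s), (s, t), (t, p), (q, s)} \<Longrightarrow>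
      J \<in> {(p, q), (q, r), (r, s), (s, t), (t, p), (q, s)} \<Longrightarrow> \<not> intervals_cross I J"
  shows "9 < \<bar>int p - int q\<bar> + \<bar>int q - int r\<bar> + \<bar>int r - int s\<bar> + \<bar>int s - int t\<bar>
    + \<bar>int t - int p\<bar> + \<bar>int q - int s\<bar>"
proof -
  \<comment> \<open>These are the six pairs of disjoint edges, in both orders; edges sharing an
    endpoint cannot satisfy the strict inequalities.\<close>
  have "\<not> intervals_cross (p, q) (r, s)" "\<not> intervals_cross (r, s) (p, q)"
    "\<not> intervals_cross (p, q) (s, t)" "\<not> intervals_cross (s, t) (p, q)"
    "\<not> intervals_cross (q, r) (s, t)" "\<not> intervals_cross (s, t) (q, r)"
    "\<not> intervals_cross (q, r) (t, p)" "\<not> intervals_cross (t, p) (q, r)"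
    "\<not> intervals_cross (r, s) (t, p)" "\<not> intervals_cross (t, p) (r, s)"
    "\<not> intervals_cross (q, s) (t, p)" "\<not> intervals_cross (t, p) (q, s)"
    by (intro nc; simp)+
  moreover have "p \<in> {1, 2, 3, 4, 5}" "q \<in> {1, 2, 3, 4, 5} - {p}" "r \<in> {1, 2, 3, 4, 5} - {p, q}"
    "s \<in> {1, 2, 3, 4, 5} - {p, q, r}" "t \<in> {1, 2, 3, 4, 5} - {p, q, r, s}"
    \<comment> \<open>Reversing the list orients each disequation with the later variable on the
      left, as the set differences require; they leave 120 cases.\<close>
    using iffD2[OF distinct_rev dist, unfolded rev.simps append.simps] ran by simp_all
  \<comment> \<open>Without the limits, linear arithmetic case-splits on the pending disequations; the crossing
    predicate is unfolded only once all five positions are numerals.\<close>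
  ultimately show ?thesis
    using [[linarith_neq_limit = 0, linarith_split_limit = 0]]
    by (auto; simp add: intervals_cross_def)
qed

theorem theorem1:
  fixes a b c d e :: 'v
    and V :: "'v set" and E :: "'v set set"
    and \<pi> :: "'v \<Rightarrow> nat"
  assumes "distinct [a, b, c, d, e]"
    and "V = {a, b, c, d, e}"
    and "E = {{a, b}, {b, c}, {c, d}, {d, e}, {e, a}, {b, d}}"
    and "minimum_planar_arrangement V E \<pi>"
  shows "arrangement_cost E \<pi> > 9"
proof -
  have "card V = 5"
    using assms(1,2) by simp
  then have bij: "bij_betw \<pi> V {1..5}" and nc: "\<forall>e\<in>E. \<forall>f\<in>E. \<not> edges_cross \<pi> e f"
    using assms(4) by (simp_all add: minimum_planar_arrangement_def linear_arrangement_def)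
  have dist: "distinct [\<pi> a, \<pi> b, \<pi> c, \<pi> d, \<pi> e]"
    using bij_betw_imp_inj_on[OF bij] assms(1,2) by (auto simp: inj_on_def)
  have "{1..5::nat} = {1, 2, 3, 4, 5}"
    by auto
  then have ran: "set [\<pi> a, \<pi> b, \<pi> c, \<pi> d, \<pi> e] \<subseteq> {1, 2, 3, 4, 5}"
    using bij_betw_imp_surj_on[OF bij] assms(2) by auto
  have "9 < \<bar>int (\<pi> a) - int (\<pi> b)\<bar> + \<bar>int (\<pi> b) - int (\<pi> c)\<bar>
      + \<bar>int (\<pi> c) - int (\<pi> d)\<bar> + \<bar>int (\<pi> d) - int (\<pi> e)\<bar> + \<bar>int (\<pi> e) - int (\<pi> a)\<bar>
      + \<bar>int (\<pi> b) - int (\<pi> d)\<bar>"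
  proof (rule noncrossing_positions_cost[OF dist ran])
    fix I J
    assume "I \<in> {(\<pi> a, \<pi> b), (\<pi> b, \<pi> c), (\<pi> c, \<pi> d), (\<pi> d, \<pi> e), (\<pi> e, \<pi> a), (\<pi> b, \<pi> d)}"
    then obtain u v where I: "I = (\<pi> u, \<pi> v)" "{u, v} \<in> E"
      unfolding assms(3) by blast
    assume "J \<in> {(\<pi> a, \<pi> b), (\<pi> b, \<pi> c), (\<pi> c, \<pi> d), (\<pi> d, \<pi> e), (\<pi> e, \<pi> a), (\<pi> b, \<pi> d)}"
    then obtain x y where J: "J = (\<pi> x, \<pi> y)" "{x, y} \<in> E"
      unfolding assms(3) by blast
    show "\<not> intervals_cross I J"
      using nc I J edges_cross_if_intervals_cross by metis
  qed
  also have "\<dots> = arrangement_cost E \<pi>"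
    \<comment> \<open>Distinct vertices make the six edges distinct sets, so the sum over
      \<open>E\<close> has exactly six terms.\<close>
    using assms(1)[simplified] unfolding arrangement_cost_def assms(3)
    by (auto simp: doubleton_eq_iff edge_length_doubleton)
  finally show ?thesis .
qed

end
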